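(* Let $G$ be a finitely generated group, regarded as a metric space via a word length metric, with a coarse quasi-action $(f_g)_{g\in G}$ on a uniformly discrete metric space $X$ with bounded geometry. Suppose that $X$ has finite asymptotic dimension and that there exists a base point $x_0\in X$ such that for every $T>0$ the $T$-quasi-stabilizer $W_T(x_0)=\{g\in G : d(f_g(x_0),x_0)\le T\}$, regarded as a metric subspace of $G$, is strongly embeddable. Then $G$ is strongly embeddable.
   Context: Bounded geometry: a metric space $X$ has bounded geometry if for all $R>0$ there is $N_R$ with $|B(x,R)|\le N_R$ for all $x\in X$. Uniformly discrete: there is $C>0$ with $d(x,y)\ge C$ for all distinct $x,y$. Balls: $B(x,S)=\{y: d(x,y)\le S\}$. Strong embeddability: a metric space $X$ is strongly embeddable if for all $R,\epsilon>0$ there is a map $\beta:X\to \ell^2(X)$, $x\mapsto\beta_x$, with $\|\beta_x\|=1$ for all $x$, such that (1) $d(x,y)\le R$ implies $\|\beta_x-\beta_y\|\le\epsilon$ (called $(R,\epsilon)$ variation); (2) $\lim_{S\to\infty}\sup_{x\in X}\sum_{w\notin B(x,S)}|\beta_x(w)|^2=0$. Finite asymptotic dimension: $X$ has finite asymptotic dimension if there is $k\ge 0$ such that for all $L\ge 0$ there is a uniformly bounded cover of $X$ with Lebesgue number at least $L$ (every ball of radius at most $L$ is contained in one element of the cover) and multiplicity $k+1$ (each point lies in at most $k+1$ elements of the cover). Coarse maps: a map $f:X\to Y$ of metric spaces is proper if inverse images of bounded sets are bounded; it is bornologous if there is a non-decreasing function $\ell:[0,\infty)\to[0,\infty)$ such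 that $d(x,x')\le r$ implies $d(f(x),f(x'))\le \ell(r)$; it is coarse if it is both proper and bornologous. Two maps $f,f':X\to Y$ are close if $d(f,f'):=\sup_{x\in X} d(f(x),f'(x))<\infty$. A coarse self-equivalence of $X$ is a coarse map $f:X\to X$ for which there is a coarse map $h:X\to X$ with $f\circ h$ and $h\circ f$ close to $\mathrm{id}_X$. Coarse quasi-action: a coarse quasi-action of a group $G$ on a metric space $X$ is an assignment of a coarse self-equivalence $f_g:X\to X$ to each $g\in G$ such that (1) all $f_g$ are coarse (bornologous) with respect to one common function $\ell$; (2) there is $A\ge 0$ with $d(f_{\mathrm{id}},\mathrm{id}_X)\le A$, where $\mathrm{id}\in G$ is the identity element; (3) there is $B\ge 0$ with $d(f_g\circ f_h,f_{gh})\le B$ for all $g,h\in G$. Word length metric: for a finite symmetric generating set $S$ of $G$, the left-invariant metric $d(g,h)$ equal to the minimal length of a word in $S$ representing $g^{-1}h$. *)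

theory Defs
  imports "HOL-Analysis.Analysis" "HOL-Algebra.Generated_Groups"
begin

text \<open>Metric spaces are given by a carrier set and a distance function, as in the locale
  \<^locale>\<open>Metric_space\<close>; a metric subspace is a smaller carrier with the same distance function.\<close>

definition bounded_geometry :: "'a set \<Rightarrow> ('a \<Rightarrow> 'a \<Rightarrow> real) \<Rightarrow> bool" where
  "bounded_geometry X d \<longleftrightarrow>
    (\<forall>R>0. \<exists>N::nat. \<forall>x\<in>X. finite (Metric_space.mcball X d x R) \<and>
                              card (Metric_space.mcball X d x R) \<le> N)"

definition uniformly_discrete :: "'a set \<Rightarrow> ('a \<Rightarrow> 'a \<Rightarrow> real) \<Rightarrow> bool" where
  "uniformly_discrete X d \<longleftrightarrow> (\<exists>C>0. \<forall>x\<in>X. \<forall>y\<in>X. x \<noteq> y \<longrightarrow> d x y \<ge> C)"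

text \<open>Elements of \<open>\<ell>\<^sup>2(X)\<close> are represented by functions on the whole type; values outside
  \<open>X\<close> are irrelevant.\<close>

definition ell2 :: "'a set \<Rightarrow> ('a \<Rightarrow> complex) set" where
  "ell2 X = {f. (\<lambda>w. (cmod (f w))\<^sup>2) summable_on X}"

definition ell2_norm :: "'a set \<Rightarrow> ('a \<Rightarrow> complex) \<Rightarrow> real" where
  "ell2_norm X f = sqrt (\<Sum>\<^sub>\<infinity>w\<in>X. (cmod (f w))\<^sup>2)"

text \<open>The supremum is taken in \<^typ>\<open>ennreal\<close>, so that it is meaningful without a boundedness proof
  and equals 0 for the empty space (quasi-stabilizers below may be empty for small \<open>T\<close>).\<close>

definition strongly_embeddable :: "'a set \<Rightarrow> ('a \<Rightarrow> 'a \<Rightarrow> real) \<Rightarrow> bool" where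
  "strongly_embeddable X d \<longleftrightarrow>
    (\<forall>R>0. \<forall>\<epsilon>>0. \<exists>\<beta> :: 'a \<Rightarrow> 'a \<Rightarrow> complex.
       (\<forall>x\<in>X. \<beta> x \<in> ell2 X \<and> ell2_norm X (\<beta> x) = 1) \<and>
       (\<forall>x\<in>X. \<forall>y\<in>X. d x y \<le> R \<longrightarrow> ell2_norm X (\<lambda>w. \<beta> x w - \<beta> y w) \<le> \<epsilon>) \<and>
       ((\<lambda>S. SUP x\<in>X. ennreal (\<Sum>\<^sub>\<infinity>w\<in>X - Metric_space.mcball X d x S. (cmod (\<beta> x w))\<^sup>2))
          \<longlongrightarrow> 0) at_top)"

definition uniformly_bounded_cover :: "'a set \<Rightarrow> ('a \<Rightarrow> 'a \<Rightarrow> real) \<Rightarrow> 'a set set \<Rightarrow> bool" where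
  "uniformly_bounded_cover X d \<U> \<longleftrightarrow>
    \<Union>\<U> = X \<and> (\<exists>D. \<forall>U\<in>\<U>. \<forall>x\<in>U. \<forall>y\<in>U. d x y \<le> D)"

definition lebesgue_number_ge :: "'a set \<Rightarrow> ('a \<Rightarrow> 'a \<Rightarrow> real) \<Rightarrow> 'a set set \<Rightarrow> real \<Rightarrow> bool" where
  "lebesgue_number_ge X d \<U> L \<longleftrightarrow>
    (\<forall>x\<in>X. \<forall>r. 0 \<le> r \<and> r \<le> L \<longrightarrow> (\<exists>U\<in>\<U>. Metric_space.mcball X d x r \<subseteq> U))"

definition multiplicity_le :: "'a set \<Rightarrow> 'a set set \<Rightarrow> nat \<Rightarrow> bool" where
  "multiplicity_le X \<U> m \<longleftrightarrow> (\<forall>x\<in>X. finite {U\<in>\<U>. x \<in> U} \<and> card {U\<in>\<U>. x \<in> U} \<le> m)"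

definition finite_asymptotic_dimension :: "'a set \<Rightarrow> ('a \<Rightarrow> 'a \<Rightarrow> real) \<Rightarrow> bool" where
  "finite_asymptotic_dimension X d \<longleftrightarrow>
    (\<exists>k::nat. \<forall>L\<ge>0. \<exists>\<U>. uniformly_bounded_cover X d \<U> \<and> lebesgue_number_ge X d \<U> L \<and>
                         multiplicity_le X \<U> (k + 1))"

definition proper_map_between ::
    "'a set \<Rightarrow> ('a \<Rightarrow> 'a \<Rightarrow> real) \<Rightarrow> 'b set \<Rightarrow> ('b \<Rightarrow> 'b \<Rightarrow> real) \<Rightarrow> ('a \<Rightarrow> 'b) \<Rightarrow> bool" where
  "proper_map_between X dX Y dY f \<longleftrightarrow>
    (\<forall>B. Metric_space.mbounded Y dY B \<longrightarrow> Metric_space.mbounded X dX {x\<in>X. f x \<in> B})"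

definition control_function :: "(real \<Rightarrow> real) \<Rightarrow> bool" where
  "control_function l \<longleftrightarrow> l \<in> {0..} \<rightarrow> {0..} \<and> mono_on {0..} l"

definition bornologous_wrt ::
    "(real \<Rightarrow> real) \<Rightarrow> 'a set \<Rightarrow> ('a \<Rightarrow> 'a \<Rightarrow> real) \<Rightarrow> ('b \<Rightarrow> 'b \<Rightarrow> real) \<Rightarrow> ('a \<Rightarrow> 'b) \<Rightarrow> bool" where
  "bornologous_wrt l X dX dY f \<longleftrightarrow>
    (\<forall>r\<ge>0. \<forall>x\<in>X. \<forall>x'\<in>X. dX x x' \<le> r \<longrightarrow> dY (f x) (f x') \<le> l r)"

definition coarse_map ::
    "'a set \<Rightarrow> ('a \<Rightarrow> 'a \<Rightarrow> real) \<Rightarrow> 'b set \<Rightarrow> ('b \<Rightarrow> 'b \<Rightarrow> real) \<Rightarrow> ('a \<Rightarrow> 'b) \<Rightarrow> bool" where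
  "coarse_map X dX Y dY f \<longleftrightarrow>
    f \<in> X \<rightarrow> Y \<and> proper_map_between X dX Y dY f \<and>
    (\<exists>l. control_function l \<and> bornologous_wrt l X dX dY f)"

definition map_dist :: "'a set \<Rightarrow> ('b \<Rightarrow> 'b \<Rightarrow> real) \<Rightarrow> ('a \<Rightarrow> 'b) \<Rightarrow> ('a \<Rightarrow> 'b) \<Rightarrow> ennreal" where
  "map_dist X dY f f' = (SUP x\<in>X. ennreal (dY (f x) (f' x)))"

definition close_maps :: "'a set \<Rightarrow> ('b \<Rightarrow> 'b \<Rightarrow> real) \<Rightarrow> ('a \<Rightarrow> 'b) \<Rightarrow> ('a \<Rightarrow> 'b) \<Rightarrow> bool" where
  "close_maps X dY f f' \<longleftrightarrow> map_dist X dY f f' < \<infinity>"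

definition coarse_self_equivalence ::
    "'a set \<Rightarrow> ('a \<Rightarrow> 'a \<Rightarrow> real) \<Rightarrow> ('a \<Rightarrow> 'a) \<Rightarrow> bool" where
  "coarse_self_equivalence X d f \<longleftrightarrow>
    coarse_map X d X d f \<and>
    (\<exists>h. coarse_map X d X d h \<and> close_maps X d (f \<circ> h) id \<and> close_maps X d (h \<circ> f) id)"

definition coarse_quasi_action ::
    "('g, 'm) monoid_scheme \<Rightarrow> 'a set \<Rightarrow> ('a \<Rightarrow> 'a \<Rightarrow> real) \<Rightarrow> ('g \<Rightarrow> 'a \<Rightarrow> 'a) \<Rightarrow> bool" where
  "coarse_quasi_action G X d f \<longleftrightarrow>
    (\<forall>g\<in>carrier G. coarse_self_equivalence X d (f g)) \<and>
    (\<exists>l. control_function l \<and> (\<forall>g\<in>carrier G. bornologous_wrt l X d d (f g))) \<and>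
    (\<exists>A\<ge>0. map_dist X d (f \<one>\<^bsub>G\<^esub>) id \<le> ennreal A) \<and>
    (\<exists>B\<ge>0. \<forall>g\<in>carrier G. \<forall>h\<in>carrier G. map_dist X d (f g \<circ> f h) (f (g \<otimes>\<^bsub>G\<^esub> h)) \<le> ennreal B)"

definition quasi_stabilizer ::
    "('g, 'm) monoid_scheme \<Rightarrow> ('a \<Rightarrow> 'a \<Rightarrow> real) \<Rightarrow> ('g \<Rightarrow> 'a \<Rightarrow> 'a) \<Rightarrow> 'a \<Rightarrow> real \<Rightarrow> 'g set" where
  "quasi_stabilizer G d f x\<^sub>0 T = {g\<in>carrier G. d (f g x\<^sub>0) x\<^sub>0 \<le> T}"

definition finite_symmetric_generating_set :: "('g, 'm) monoid_scheme \<Rightarrow> 'g set \<Rightarrow> bool" where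
  "finite_symmetric_generating_set G S \<longleftrightarrow>
    finite S \<and> S \<subseteq> carrier G \<and> (\<forall>s\<in>S. inv\<^bsub>G\<^esub> s \<in> S) \<and> generate G S = carrier G"

definition word_length :: "('g, 'm) monoid_scheme \<Rightarrow> 'g set \<Rightarrow> 'g \<Rightarrow> nat" where
  "word_length G S g =
    (LEAST n. \<exists>ws. set ws \<subseteq> S \<and> length ws = n \<and> foldr (\<otimes>\<^bsub>G\<^esub>) ws \<one>\<^bsub>G\<^esub> = g)"

text \<open>The value off the carrier is fixed to 0 because \<^locale>\<open>Metric_space\<close> requires
  symmetry for all pairs of the underlying type.\<close>

definition word_dist :: "('g, 'm) monoid_scheme \<Rightarrow> 'g set \<Rightarrow> 'g \<Rightarrow> 'g \<Rightarrow> real" where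
  "word_dist G S g h =
    (if g \<in> carrier G \<and> h \<in> carrier G then real (word_length G S (inv\<^bsub>G\<^esub> g \<otimes>\<^bsub>G\<^esub> h)) else 0)"

context group
begin

lemma foldr_mult_closed: "set ws \<subseteq> carrier G \<Longrightarrow> foldr (\<otimes>) ws \<one> \<in> carrier G"
  by (induction ws) auto

lemma foldr_mult_append:
  "set us \<subseteq> carrier G \<Longrightarrow> set vs \<subseteq> carrier G \<Longrightarrow>
    foldr (\<otimes>) (us @ vs) \<one> = foldr (\<otimes>) us \<one> \<otimes> foldr (\<otimes>) vs \<one>"
  by (induction us) (auto simp: m_assoc foldr_mult_closed simp del: foldr_append)

lemma foldr_mult_inv:
  "set ws \<subseteq> carrier G \<Longrightarrow>
    foldr (\<otimes>) (rev (map (m_inv G) ws)) \<one> = inv (foldr (\<otimes>) ws \<one>)"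
proof (induction ws)
  case (Cons a ws)
  have "set (rev (map (m_inv G) ws)) \<subseteq> carrier G" using Cons.prems by auto
  with Cons show ?case
    using foldr_mult_append[of "rev (map (m_inv G) ws)" "[inv a]"]
    by (simp add: inv_mult_group foldr_mult_closed del: foldr_append)
qed auto

context
  fixes S
  assumes S: "finite_symmetric_generating_set G S"
begin

lemma word_exists:
  assumes "g \<in> carrier G"
  shows "\<exists>ws. set ws \<subseteq> S \<and> foldr (\<otimes>) ws \<one> = g"
proof -
  have sub: "S \<subseteq> carrier G" and sym: "\<And>s. s \<in> S \<Longrightarrow> inv s \<in> S"
    using S by (auto simp: finite_symmetric_generating_set_def)
  have "g \<in> generate G S" using S assms by (simp add: finite_symmetric_generating_set_def)
  then show ?thesis
  proof (induction rule: generate.induct)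
    case one show ?case by (rule exI[of _ "[]"]) simp
  next
    case (incl h) then show ?case using sub by (intro exI[of _ "[h]"]) auto
  next
    case (inv h) then show ?case using sub sym by (intro exI[of _ "[inv h]"]) auto
  next
    case (eng h1 h2)
    then obtain us vs where "set us \<subseteq> S" "foldr (\<otimes>) us \<one> = h1" "set vs \<subseteq> S" "foldr (\<otimes>) vs \<one> = h2"
      by auto
    then show ?case using sub foldr_mult_append[of us vs]
      by (intro exI[of _ "us @ vs"]) (auto simp del: foldr_append)
  qed
qed

lemma word_length_witness:
  assumes "g \<in> carrier G"
  obtains ws where "set ws \<subseteq> S" "length ws = word_length G S g" "foldr (\<otimes>) ws \<one> = g"
proof -
  have "\<exists>n ws. set ws \<subseteq> S \<and> length ws = n \<and> foldr (\<otimes>) ws \<one> = g"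
    using word_exists[OF assms] by auto
  from LeastI_ex[OF this] show ?thesis using that by (auto simp: word_length_def)
qed

lemma word_length_le: "set ws \<subseteq> S \<Longrightarrow> word_length G S (foldr (\<otimes>) ws \<one>) \<le> length ws"
  unfolding word_length_def by (rule Least_le) blast

lemma word_length_eq_0_iff:
  assumes "g \<in> carrier G"
  shows "word_length G S g = 0 \<longleftrightarrow> g = \<one>"
proof -
  obtain ws where "length ws = word_length G S g" "foldr (\<otimes>) ws \<one> = g"
    using word_length_witness[OF assms] .
  then show ?thesis using word_length_le[of "[]"] by (cases ws) auto
qed

lemma word_length_mult:
  assumes "g \<in> carrier G" "h \<in> carrier G"
  shows "word_length G S (g \<otimes> h) \<le> word_length G S g + word_length G S h"
proof -
  obtain us where us: "set us \<subseteq> S" "length us = word_length G S g" "foldr (\<otimes>) us \<one> = g"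
    using word_length_witness[OF assms(1)] .
  obtain vs where vs: "set vs \<subseteq> S" "length vs = word_length G S h" "foldr (\<otimes>) vs \<one> = h"
    using word_length_witness[OF assms(2)] .
  have "S \<subseteq> carrier G" using S by (simp add: finite_symmetric_generating_set_def)
  then have "foldr (\<otimes>) (us @ vs) \<one> = g \<otimes> h" using us vs by (subst foldr_mult_append) auto
  then show ?thesis using word_length_le[of "us @ vs"] us vs by auto
qed

lemma word_length_inv_le:
  assumes "g \<in> carrier G"
  shows "word_length G S (inv g) \<le> word_length G S g"
proof -
  obtain us where us: "set us \<subseteq> S" "length us = word_length G S g" "foldr (\<otimes>) us \<one> = g"
    using word_length_witness[OF assms(1)] .
  have sub: "S \<subseteq> carrier G" and sym: "\<And>s. s \<in> S \<Longrightarrow> inv s \<in> S"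
    using S by (auto simp: finite_symmetric_generating_set_def)
  have "foldr (\<otimes>) (rev (map (m_inv G) us)) \<one> = inv g" using us sub by (subst foldr_mult_inv) auto
  moreover have "set (rev (map (m_inv G) us)) \<subseteq> S" using us sym by auto
  ultimately show ?thesis using word_length_le[of "rev (map (m_inv G) us)"] us by auto
qed

lemma Metric_space_word_dist: "Metric_space (carrier G) (word_dist G S)"
proof
  fix x y show "0 \<le> word_dist G S x y" by (simp add: word_dist_def)
next
  have le: "word_length G S (inv x \<otimes> y) \<le> word_length G S (inv y \<otimes> x)"
    if "x \<in> carrier G" "y \<in> carrier G" for x y
    using word_length_inv_le[of "inv y \<otimes> x"] that by (simp add: inv_mult_group)
  fix x y show "word_dist G S x y = word_dist G S y x"
    using le[of x y] le[of y x] by (auto simp: word_dist_def)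
next
  fix x y assume xy: "x \<in> carrier G" "y \<in> carrier G"
  have "inv x \<otimes> y = \<one> \<longleftrightarrow> x = y"
    using inv_solve_left'[of \<one> x y] xy by auto
  then show "word_dist G S x y = 0 \<longleftrightarrow> x = y"
    using xy word_length_eq_0_iff[of "inv x \<otimes> y"] by (simp add: word_dist_def)
next
  fix x y z assume *: "x \<in> carrier G" "y \<in> carrier G" "z \<in> carrier G"
  then have "inv x \<otimes> z = (inv x \<otimes> y) \<otimes> (inv y \<otimes> z)"
    by (simp add: m_assoc m_assoc[symmetric, of y "inv y" z])
  then show "word_dist G S x z \<le> word_dist G S x y + word_dist G S y z"
    using word_length_mult[of "inv x \<otimes> y" "inv y \<otimes> z"] * by (simp add: word_dist_def)
qed

end

end

end

theory Submission
  imports Defs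
begin

text \<open>Squaring the vectors \<open>\<beta>\<^sub>x\<close> turns strong embeddability into the existence of probability
  measures on the space with small \<open>\<ell>\<^sup>1\<close>-variation and uniformly small tails, and such measures can
  be averaged. The orbit map \<open>\<pi> g = f\<^sub>g(x\<^sub>0)\<close> is bornologous. Pull back along it a cover of \<open>X\<close> of
  large Lebesgue number, together with a partition of unity of small variation. Each piece
  \<open>V\<^sub>U = \<pi>\<^sup>-\<^sup>1(U)\<close> is moved by a left translation into one and the same quasi-stabilizer, so the
  measures of the quasi-stabilizer, translated back to the pieces, have a common variation
  and common tails; their averages with respect to the partition of unity embed \<open>G\<close>.\<close>

section \<open>Strong embeddability by probability measures\<close>

text \<open>The measures live on \<open>X\<close> but are required only at the points of \<open>V\<close>; the tail radius \<open>\<tau>\<close> is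
  explicit so that all pieces of a cover can share it.\<close>

definition controlled_measures ::
    "'a set \<Rightarrow> ('a \<Rightarrow> 'a \<Rightarrow> real) \<Rightarrow> 'a set \<Rightarrow> real \<Rightarrow> real \<Rightarrow> (real \<Rightarrow> real) \<Rightarrow> ('a \<Rightarrow> 'a \<Rightarrow> real) \<Rightarrow> bool"
  where
  "controlled_measures X d V R \<epsilon> \<tau> p \<longleftrightarrow>
    (\<forall>x\<in>V. (\<forall>w\<in>X. 0 \<le> p x w) \<and> (p x has_sum 1) X) \<and>
    (\<forall>x\<in>V. \<forall>y\<in>V. d x y \<le> R \<longrightarrow> (\<Sum>\<^sub>\<infinity>w\<in>X. \<bar>p x w - p y w\<bar>) \<le> \<epsilon>) \<and>
    (\<forall>\<delta>>0. \<forall>x\<in>V. (\<Sum>\<^sub>\<infinity>w\<in>{w\<in>X. \<tau> \<delta> < d x w}. p x w) \<le> \<delta>)"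

section \<open>Summability and elementary inequalities\<close>

lemma summable_on_abs_diff:
  fixes f g :: "'a \<Rightarrow> real"
  assumes "f summable_on A" "g summable_on A"
  shows "(\<lambda>w. \<bar>f w - g w\<bar>) summable_on A"
proof -
  have "(\<lambda>w. f w + - g w) summable_on A"
    using assms by (intro summable_on_add summable_on_uminus[THEN iffD2])
  then have "(\<lambda>w. norm (f w + - g w)) summable_on A"
    by (rule summable_on_iff_abs_summable_on_real[THEN iffD1])
  then show ?thesis by simp
qed

lemma has_sum_finite_sum:
  fixes f :: "'i \<Rightarrow> 'a \<Rightarrow> real"
  assumes "finite I" "\<And>i. i \<in> I \<Longrightarrow> (f i has_sum s i) A"
  shows "((\<lambda>w. \<Sum>i\<in>I. f i w) has_sum (\<Sum>i\<in>I. s i)) A"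
  using assms
proof (induction I rule: finite_induct)
  case (insert j I)
  have "((\<lambda>w. f j w + (\<Sum>i\<in>I. f i w)) has_sum (s j + (\<Sum>i\<in>I. s i))) A"
    using insert by (intro has_sum_add) simp_all
  then show ?case using insert by simp
qed simp

lemma tail_set_eq:
  assumes "Metric_space X d" "x \<in> X"
  shows "X - Metric_space.mcball X d x S = {w \<in> X. S < d x w}"
  using assms by (auto simp: Metric_space.mcball_def)

text \<open>Factor \<open>a - b\<close> through square roots: the smaller factor
  \<open>\<bar>sqrt a - sqrt b\<bar>\<close> is at most \<open>sqrt a + sqrt b\<close>. Summed over
  the space, this bounds the squared distance of square-root vectors by the distance of the
  measures.\<close>

lemma sqrt_diff_square_le:
  fixes a b :: real
  assumes "0 \<le> a" "0 \<le> b"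
  shows "(sqrt a - sqrt b)\<^sup>2 \<le> \<bar>a - b\<bar>"
proof -
  have *: "\<bar>sqrt a - sqrt b\<bar> \<le> sqrt a + sqrt b" using assms by (auto simp: abs_le_iff)
  have "(sqrt a - sqrt b)\<^sup>2 = \<bar>sqrt a - sqrt b\<bar> * \<bar>sqrt a - sqrt b\<bar>"
    by (simp add: power2_eq_square)
  also have "\<dots> \<le> \<bar>sqrt a - sqrt b\<bar> * (sqrt a + sqrt b)"
    by (rule mult_left_mono[OF *]) simp
  also have "\<dots> = \<bar>(sqrt a - sqrt b) * (sqrt a + sqrt b)\<bar>"
    using assms by (simp add: abs_mult)
  also have "\<dots> = \<bar>a - b\<bar>" using assms by (simp add: algebra_simps)
  finally show ?thesis .
qed

text \<open>A weighted arithmetic-geometric mean inequality that replaces Cauchy-Schwarz. Being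
  pointwise, it can be summed over the space by termwise comparison, with the weight
  \<open>t\<close> chosen afterwards.\<close>

lemma abs_diff_squares_le:
  fixes u v :: complex
  assumes "0 < t"
  shows "\<bar>(cmod u)\<^sup>2 - (cmod v)\<^sup>2\<bar> \<le> (cmod (u - v))\<^sup>2 / t + t * ((cmod u)\<^sup>2 + (cmod v)\<^sup>2)"
proof -
  define a b c where "a = cmod u" and "b = cmod v" and "c = cmod (u - v)"
  have c: "\<bar>a - b\<bar> \<le> c" unfolding a_def b_def c_def by (rule norm_triangle_ineq3)
  have ab: "0 \<le> a" "0 \<le> b" by (simp_all add: a_def b_def)
  have "\<bar>a\<^sup>2 - b\<^sup>2\<bar> = \<bar>a - b\<bar> * (a + b)"
    using ab by (simp add: power2_eq_square square_diff_square_factored abs_mult)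
  also have "\<dots> \<le> c * (a + b)" using c ab by (intro mult_right_mono) auto
  also have "\<dots> \<le> c\<^sup>2 / t + t * (a\<^sup>2 + b\<^sup>2)"
  proof -
    \<comment> \<open>Completing the square: the second summand fills \<open>(a + b)^2 / 4\<close>
      up to \<open>a^2 + b^2\<close>.\<close>
    have "0 \<le> (c - t * (a + b) / 2)\<^sup>2 + t\<^sup>2 * ((a - b)\<^sup>2 / 4 + (a\<^sup>2 + b\<^sup>2) / 2)" by simp
    also have "\<dots> = c\<^sup>2 + t\<^sup>2 * (a\<^sup>2 + b\<^sup>2) - t * (c * (a + b))"
      by (simp add: power2_eq_square field_simps)
    finally show ?thesis using assms by (simp add: field_simps power2_eq_square)
  qed
  finally show ?thesis by (simp add: a_def b_def c_def)
qed

section \<open>Passage between unit vectors and probability measures\<close>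

lemma strongly_embeddable_imp_controlled_measures:
  assumes M: "Metric_space X d" and se: "strongly_embeddable X d" and "0 < R" "0 < \<epsilon>"
  obtains \<tau> p where "controlled_measures X d X R \<epsilon> \<tau> p"
proof -
  \<comment> \<open>The vectors are taken with variation \<open>t\<close>. Since both measures have
    mass 1, the weighted inequality gives variation at most \<open>t^2 / t + 2 * t\<close>, which is
    \<open>\<epsilon>\<close>.\<close>
  define t where "t = \<epsilon> / 3"
  have t: "0 < t" using \<open>0 < \<epsilon>\<close> by (simp add: t_def)
  obtain \<beta> :: "'a \<Rightarrow> 'a \<Rightarrow> complex" where
    \<beta>1: "\<And>x. x \<in> X \<Longrightarrow> \<beta> x \<in> ell2 X \<and> ell2_norm X (\<beta> x) = 1" and
    \<beta>2: "\<And>x y. x \<in> X \<Longrightarrow> y \<in> X \<Longrightarrow> d x y \<le> R \<Longrightarrow> ell2_norm X (\<lambda>w. \<beta> x w - \<beta> y w) \<le> t" and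
    \<beta>3: "((\<lambda>S. SUP x\<in>X. ennreal (\<Sum>\<^sub>\<infinity>w\<in>X - Metric_space.mcball X d x S. (cmod (\<beta> x w))\<^sup>2)) \<longlongrightarrow> 0) at_top"
    using se[unfolded strongly_embeddable_def, rule_format, OF \<open>0 < R\<close> t] by blast
  define p where "p x w = (cmod (\<beta> x w))\<^sup>2" for x w
  have p_nonneg: "0 \<le> p x w" for x w by (simp add: p_def)
  have sum1: "(p x has_sum 1) X" if "x \<in> X" for x
    using \<beta>1[OF that] unfolding has_sum_iff p_def ell2_def ell2_norm_def by auto
  \<comment> \<open>The limit of the suprema yields one radius for all \<open>x\<close>; choosing it
    for each \<open>\<delta>\<close> defines \<open>\<tau>\<close>.\<close>
  have "\<exists>S. \<forall>x\<in>X. (\<Sum>\<^sub>\<infinity>w\<in>{w\<in>X. S < d x w}. p x w) \<le> \<delta>" if "0 < \<delta>" for \<delta>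
  proof -
    have "\<forall>\<^sub>F S in at_top. (SUP x\<in>X. ennreal (\<Sum>\<^sub>\<infinity>w\<in>X - Metric_space.mcball X d x S. (cmod (\<beta> x w))\<^sup>2)) < ennreal \<delta>"
      using order_tendstoD(2)[OF \<beta>3] that by simp
    then obtain S where S: "(SUP x\<in>X. ennreal (\<Sum>\<^sub>\<infinity>w\<in>X - Metric_space.mcball X d x S. (cmod (\<beta> x w))\<^sup>2)) < ennreal \<delta>"
      by (auto simp: eventually_at_top_linorder)
    have "(\<Sum>\<^sub>\<infinity>w\<in>{w\<in>X. S < d x w}. p x w) \<le> \<delta>" if x: "x \<in> X" for x
    proof -
      have "ennreal (\<Sum>\<^sub>\<infinity>w\<in>X - Metric_space.mcball X d x S. (cmod (\<beta> x w))\<^sup>2) \<le> ennreal \<delta>"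
        using SUP_upper[OF x] S by (meson less_imp_le order_trans)
      then show ?thesis using \<open>0 < \<delta>\<close> by (simp add: tail_set_eq[OF M x] p_def)
    qed
    then show ?thesis by blast
  qed
  then obtain \<tau> where \<tau>: "\<And>\<delta> x. 0 < \<delta> \<Longrightarrow> x \<in> X \<Longrightarrow> (\<Sum>\<^sub>\<infinity>w\<in>{w\<in>X. \<tau> \<delta> < d x w}. p x w) \<le> \<delta>"
    by metis
  have var: "(\<Sum>\<^sub>\<infinity>w\<in>X. \<bar>p x w - p y w\<bar>) \<le> \<epsilon>" if xy: "x \<in> X" "y \<in> X" "d x y \<le> R" for x y
  proof -
    let ?D = "\<lambda>w. (cmod (\<beta> x w - \<beta> y w))\<^sup>2"
    have px: "p x summable_on X" and py: "p y summable_on X"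
      using sum1 xy by (auto simp: has_sum_iff)
    \<comment> \<open>Summability of \<open>?D\<close> has to be shown separately:
      \<open>infsum\<close> is 0 on families that are not summable, so the bound on
      \<open>ell2_norm\<close> alone carries no information.\<close>
    have "?D w \<le> 2 * (p x w + p y w)" for w
    proof -
      have "?D w \<le> (cmod (\<beta> x w) + cmod (\<beta> y w))\<^sup>2"
        by (intro power_mono norm_triangle_ineq4) simp
      also have "\<dots> \<le> 2 * (p x w + p y w)"
        using zero_le_power2[of "cmod (\<beta> x w) - cmod (\<beta> y w)"]
        by (simp add: p_def power2_eq_square algebra_simps)
      finally show ?thesis .
    qed
    moreover have "(\<lambda>w. 2 * (p x w + p y w)) summable_on X"
      by (rule summable_on_cmult_right[OF summable_on_add[OF px py]])
    ultimately have D: "?D summable_on X"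
      by (intro summable_on_comparison_test[where g = ?D and f = "\<lambda>w. 2 * (p x w + p y w)"]) simp_all
    have "sqrt (infsum ?D X) \<le> t" using \<beta>2[OF xy] by (simp add: ell2_norm_def)
    then have D_le: "infsum ?D X \<le> t * t"
      using sqrt_le_D by (simp add: power2_eq_square)
    have "((\<lambda>w. ?D w * (1 / t) + t * (p x w + p y w)) has_sum (infsum ?D X * (1 / t) + t * (1 + 1))) X"
      using D sum1 xy by (intro has_sum_add has_sum_cmult_left has_sum_cmult_right has_sum_infsum) auto
    then have "(\<Sum>\<^sub>\<infinity>w\<in>X. \<bar>p x w - p y w\<bar>) \<le> infsum ?D X * (1 / t) + t * (1 + 1)"
      by (rule has_sum_mono[OF has_sum_infsum[OF summable_on_abs_diff[OF px py]]])
        (use abs_diff_squares_le[OF t] in \<open>auto simp: p_def\<close>)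
    also have "\<dots> \<le> t * t * (1 / t) + t * (1 + 1)"
      using D_le t by (intro add_right_mono mult_right_mono) auto
    also have "\<dots> = \<epsilon>" using t by (simp add: t_def)
    finally show ?thesis .
  qed
  have "controlled_measures X d X R \<epsilon> \<tau> p"
    unfolding controlled_measures_def using sum1 var \<tau> p_nonneg by blast
  then show thesis by (rule that)
qed

text \<open>Take pointwise square roots of measures with variation \<open>\<epsilon>^2\<close>. By
  \<open>sqrt_diff_square_le\<close> the vectors vary by at most \<open>\<epsilon>\<close>, and
  their tails are those of the measures.\<close>

lemma strongly_embeddable_if_controlled_measures:
  assumes M: "Metric_space X d"
    and ex: "\<And>R \<epsilon>. 0 < R \<Longrightarrow> 0 < \<epsilon> \<Longrightarrow> \<exists>\<tau> p. controlled_measures X d X R \<epsilon> \<tau> p"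
  shows "strongly_embeddable X d"
  unfolding strongly_embeddable_def
proof (intro allI impI)
  fix R \<epsilon> :: real assume "0 < R" "0 < \<epsilon>"
  then obtain \<tau> p where "controlled_measures X d X R (\<epsilon>\<^sup>2) \<tau> p"
    using ex[of R "\<epsilon>\<^sup>2"] by auto
  then have pos: "\<And>x w. x \<in> X \<Longrightarrow> w \<in> X \<Longrightarrow> 0 \<le> p x w"
    and sum1: "\<And>x. x \<in> X \<Longrightarrow> (p x has_sum 1) X"
    and var: "\<And>x y. x \<in> X \<Longrightarrow> y \<in> X \<Longrightarrow> d x y \<le> R \<Longrightarrow> (\<Sum>\<^sub>\<infinity>w\<in>X. \<bar>p x w - p y w\<bar>) \<le> \<epsilon>\<^sup>2"
    and tail: "\<And>\<delta> x. 0 < \<delta> \<Longrightarrow> x \<in> X \<Longrightarrow> (\<Sum>\<^sub>\<infinity>w\<in>{w\<in>X. \<tau> \<delta> < d x w}. p x w) \<le> \<delta>"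
    unfolding controlled_measures_def by auto
  define \<beta> where "\<beta> x w = complex_of_real (sqrt (p x w))" for x w
  have \<beta>: "(cmod (\<beta> x w))\<^sup>2 = p x w" if "x \<in> X" "w \<in> X" for x w
    using pos[OF that] by (simp add: \<beta>_def)
  have hs: "((\<lambda>w. (cmod (\<beta> x w))\<^sup>2) has_sum 1) X" if "x \<in> X" for x
    using sum1[OF that] \<beta>[OF that] by (subst has_sum_cong[of X _ "p x"]) auto
  have "ell2_norm X (\<lambda>w. \<beta> x w - \<beta> y w) \<le> \<epsilon>" if xy: "x \<in> X" "y \<in> X" "d x y \<le> R" for x y
  proof -
    have S: "(\<lambda>w. \<bar>p x w - p y w\<bar>) summable_on X"
      using sum1 xy by (intro summable_on_abs_diff) (auto simp: has_sum_iff)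
    have le: "(cmod (\<beta> x w - \<beta> y w))\<^sup>2 \<le> \<bar>p x w - p y w\<bar>" if "w \<in> X" for w
      using sqrt_diff_square_le[OF pos[OF xy(1) that] pos[OF xy(2) that]]
      by (simp add: \<beta>_def flip: of_real_diff)
    have "(\<Sum>\<^sub>\<infinity>w\<in>X. (cmod (\<beta> x w - \<beta> y w))\<^sup>2) \<le> (\<Sum>\<^sub>\<infinity>w\<in>X. \<bar>p x w - p y w\<bar>)"
      using summable_on_comparison_test[OF S le] by (intro infsum_mono S le) auto
    also have "\<dots> \<le> \<epsilon>\<^sup>2" by (rule var[OF xy])
    finally show ?thesis
      unfolding ell2_norm_def using \<open>0 < \<epsilon>\<close> by (intro real_le_lsqrt) (auto intro: infsum_nonneg)
  qed
  moreover have "((\<lambda>S. SUP x\<in>X. ennreal (\<Sum>\<^sub>\<infinity>w\<in>X - Metric_space.mcball X d x S. (cmod (\<beta> x w))\<^sup>2)) \<longlongrightarrow> 0) at_top"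
  proof (rule order_tendstoI)
    fix a :: ennreal assume "0 < a"
    \<comment> \<open>An intermediate value is finite even when \<open>a\<close> is infinite, hence
      comes from a positive real \<open>\<delta>\<close>; it also turns the weak bound from
      \<open>SUP_least\<close> into a strict one.\<close>
    then obtain c where c: "0 < c" "c < a" using dense by blast
    then obtain \<delta> where \<delta>: "0 < \<delta>" "ennreal \<delta> = c"
      by (cases c) (auto simp: ennreal_less_iff)
    have le: "(SUP x\<in>X. ennreal (\<Sum>\<^sub>\<infinity>w\<in>X - Metric_space.mcball X d x S. (cmod (\<beta> x w))\<^sup>2)) \<le> ennreal \<delta>"
      if "\<tau> \<delta> \<le> S" for S
    proof (rule SUP_least)
      fix x assume x: "x \<in> X"
      have "(\<Sum>\<^sub>\<infinity>w\<in>{w\<in>X. S < d x w}. (cmod (\<beta> x w))\<^sup>2) = (\<Sum>\<^sub>\<infinity>w\<in>{w\<in>X. S < d x w}. p x w)"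
        using \<beta>[OF x] by (intro infsum_cong) auto
      also have "\<dots> \<le> (\<Sum>\<^sub>\<infinity>w\<in>{w\<in>X. \<tau> \<delta> < d x w}. p x w)"
        using sum1[OF x] pos[OF x] that
        by (intro infsum_mono2) (auto simp: has_sum_iff intro: summable_on_subset_banach)
      also have "\<dots> \<le> \<delta>" by (rule tail[OF \<delta>(1) x])
      finally show "ennreal (\<Sum>\<^sub>\<infinity>w\<in>X - Metric_space.mcball X d x S. (cmod (\<beta> x w))\<^sup>2) \<le> ennreal \<delta>"
        by (simp add: tail_set_eq[OF M x] ennreal_leI)
    qed
    show "\<forall>\<^sub>F S in at_top. (SUP x\<in>X. ennreal (\<Sum>\<^sub>\<infinity>w\<in>X - Metric_space.mcball X d x S. (cmod (\<beta> x w))\<^sup>2)) < a"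
      using \<delta> c
      by (intro eventually_mono[OF eventually_ge_at_top[of "\<tau> \<delta>"]] order.strict_trans1[OF le]) auto
  qed auto
  ultimately show "\<exists>\<beta> :: 'a \<Rightarrow> 'a \<Rightarrow> complex.
       (\<forall>x\<in>X. \<beta> x \<in> ell2 X \<and> ell2_norm X (\<beta> x) = 1) \<and>
       (\<forall>x\<in>X. \<forall>y\<in>X. d x y \<le> R \<longrightarrow> ell2_norm X (\<lambda>w. \<beta> x w - \<beta> y w) \<le> \<epsilon>) \<and>
       ((\<lambda>S. SUP x\<in>X. ennreal (\<Sum>\<^sub>\<infinity>w\<in>X - Metric_space.mcball X d x S. (cmod (\<beta> x w))\<^sup>2))
          \<longlongrightarrow> 0) at_top"
    using hs by (intro exI[of _ \<beta>]) (auto simp: ell2_def ell2_norm_def has_sum_iff)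
qed

section \<open>Transport and gluing\<close>

text \<open>Here \<open>h\<close> stands for a left translation that moves the piece
  \<open>V\<close> into the quasi-stabilizer \<open>W\<close>. The measures on \<open>W\<close> are
  extended by zero to \<open>Y\<close> and pulled back along \<open>h\<close>. An isometry preserves
  both variation and tails, so \<open>\<epsilon>\<close> and \<open>\<tau>\<close> depend neither on
  \<open>V\<close> nor on \<open>h\<close>.\<close>

lemma controlled_measures_transport:
  assumes cm: "controlled_measures W d W R \<epsilon> \<tau> p"
    and "W \<subseteq> Y" and bij: "bij_betw h Y Y"
    and iso: "\<And>x y. x \<in> Y \<Longrightarrow> y \<in> Y \<Longrightarrow> d (h x) (h y) = d x y"
    and "V \<subseteq> Y" and V: "h ` V \<subseteq> W"
  shows "controlled_measures Y d V R \<epsilon> \<tau> (\<lambda>x w. if h w \<in> W then p (h x) (h w) else 0)"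
proof -
  \<comment> \<open>Reindexing along \<open>h\<close> followed by discarding the points outside
    \<open>W\<close>; it serves the variation with \<open>P\<close> constantly true and the tails
    with \<open>P\<close> a distance condition.\<close>
  have infsum_h: "(\<Sum>\<^sub>\<infinity>w\<in>{w\<in>Y. P (h w)}. F (h w)) = infsum F {w\<in>W. P w}"
    if "\<And>w. w \<notin> W \<Longrightarrow> F w = 0" for F :: "'a \<Rightarrow> real" and P
  proof -
    have "bij_betw h {w\<in>Y. P (h w)} {w\<in>Y. P w}"
      using bij by (auto simp: bij_betw_def inj_on_def)
    then have "(\<Sum>\<^sub>\<infinity>w\<in>{w\<in>Y. P (h w)}. F (h w)) = infsum F {w\<in>Y. P w}"
      by (rule infsum_reindex_bij_betw)
    also have "\<dots> = infsum F {w\<in>W. P w}"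
      using that \<open>W \<subseteq> Y\<close> by (intro infsum_cong_neutral) auto
    finally show ?thesis .
  qed
  show ?thesis unfolding controlled_measures_def
  proof (intro conjI ballI allI impI)
    fix x w assume "x \<in> V" "w \<in> Y"
    then show "0 \<le> (if h w \<in> W then p (h x) (h w) else 0)"
      using cm V by (auto simp: controlled_measures_def)
  next
    fix x assume "x \<in> V"
    then have "(p (h x) has_sum 1) W" using cm V by (auto simp: controlled_measures_def)
    then have "((\<lambda>w. if w \<in> W then p (h x) w else 0) has_sum 1) Y"
      by (rule has_sum_cong_neutral[THEN iffD1, rotated -1]) (use \<open>W \<subseteq> Y\<close> in auto)
    then show "((\<lambda>w. if h w \<in> W then p (h x) (h w) else 0) has_sum 1) Y"
      using has_sum_reindex_bij_betw[OF bij, of "\<lambda>w. if w \<in> W then p (h x) w else 0"] by simp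
  next
    fix x y assume xy: "x \<in> V" "y \<in> V" "d x y \<le> R"
    let ?F = "\<lambda>w. \<bar>(if w \<in> W then p (h x) w else 0) - (if w \<in> W then p (h y) w else 0)\<bar>"
    have "(\<Sum>\<^sub>\<infinity>w\<in>Y. ?F (h w)) = infsum ?F W"
      using infsum_h[of ?F "\<lambda>_. True"] by simp
    also have "\<dots> = (\<Sum>\<^sub>\<infinity>w\<in>W. \<bar>p (h x) w - p (h y) w\<bar>)" by (intro infsum_cong) auto
    also have "\<dots> \<le> \<epsilon>"
    proof -
      have "h x \<in> W" "h y \<in> W" "d (h x) (h y) \<le> R"
        using xy iso V \<open>V \<subseteq> Y\<close> by (auto simp: subset_iff)
      then show ?thesis using cm by (auto simp: controlled_measures_def)
    qed
    finally show "(\<Sum>\<^sub>\<infinity>w\<in>Y. ?F (h w)) \<le> \<epsilon>" .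
  next
    fix \<delta> :: real and x assume "0 < \<delta>" "x \<in> V"
    let ?F = "\<lambda>w. if w \<in> W then p (h x) w else 0"
    have "{w\<in>Y. \<tau> \<delta> < d x w} = {w\<in>Y. \<tau> \<delta> < d (h x) (h w)}"
      using iso \<open>x \<in> V\<close> \<open>V \<subseteq> Y\<close> by (auto simp: subset_iff)
    then have "(\<Sum>\<^sub>\<infinity>w\<in>{w\<in>Y. \<tau> \<delta> < d x w}. ?F (h w)) = infsum ?F {w\<in>W. \<tau> \<delta> < d (h x) w}"
      using infsum_h[of ?F "\<lambda>w. \<tau> \<delta> < d (h x) w"] by simp
    also have "\<dots> = infsum (p (h x)) {w\<in>W. \<tau> \<delta> < d (h x) w}" by (intro infsum_cong) auto
    also have "\<dots> \<le> \<delta>"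
      using cm V \<open>x \<in> V\<close> \<open>0 < \<delta>\<close> by (auto simp: controlled_measures_def)
    finally show "(\<Sum>\<^sub>\<infinity>w\<in>{w\<in>Y. \<tau> \<delta> < d x w}. ?F (h w)) \<le> \<delta>" .
  qed
qed

text \<open>Convex combinations. Each difference splits as \<open>(\<phi> i x - \<phi> i y) * q i x
  w + \<phi> i y * (q i x w - q i y w)\<close>; the first part costs \<open>\<epsilon>\<close> by
  the variation of the weights, the second \<open>\<epsilon>'\<close> by convexity. A tail of the
  combination is an average of tails, so \<open>\<tau>\<close> is kept. Values of \<open>q i\<close>
  where \<open>\<phi> i\<close> vanishes never contribute.\<close>

lemma controlled_measures_glue:
  fixes \<phi> :: "'i \<Rightarrow> 'a \<Rightarrow> real"
  defines "I \<equiv> \<lambda>x. {i. \<phi> i x \<noteq> 0}"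
  assumes nonneg: "\<And>i x. x \<in> Y \<Longrightarrow> 0 \<le> \<phi> i x"
    and fin: "\<And>x. x \<in> Y \<Longrightarrow> finite (I x)"
    and part: "\<And>x. x \<in> Y \<Longrightarrow> (\<Sum>i\<in>I x. \<phi> i x) = 1"
    and \<phi>_var: "\<And>x y. x \<in> Y \<Longrightarrow> y \<in> Y \<Longrightarrow> d x y \<le> R \<Longrightarrow> (\<Sum>i\<in>I x \<union> I y. \<bar>\<phi> i x - \<phi> i y\<bar>) \<le> \<epsilon>"
    and cm: "\<And>i. controlled_measures Y d {x\<in>Y. \<phi> i x \<noteq> 0} R \<epsilon>' \<tau> (q i)"
    and "0 \<le> \<epsilon>'"
  shows "controlled_measures Y d Y R (\<epsilon> + \<epsilon>') \<tau> (\<lambda>x w. \<Sum>i\<in>I x. \<phi> i x * q i x w)"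
proof -
  have q0: "0 \<le> q i x w" if "x \<in> Y" "\<phi> i x \<noteq> 0" "w \<in> Y" for i x w
    using cm[of i] that by (auto simp: controlled_measures_def)
  have q1: "(q i x has_sum 1) Y" if "x \<in> Y" "\<phi> i x \<noteq> 0" for i x
    using cm[of i] that by (auto simp: controlled_measures_def)
  have q2: "(\<Sum>\<^sub>\<infinity>w\<in>Y. \<bar>q i x w - q i y w\<bar>) \<le> \<epsilon>'"
    if "x \<in> Y" "y \<in> Y" "\<phi> i x \<noteq> 0" "\<phi> i y \<noteq> 0" "d x y \<le> R" for i x y
    using cm[of i] that by (auto simp: controlled_measures_def)
  have q3: "(\<Sum>\<^sub>\<infinity>w\<in>{w\<in>Y. \<tau> \<delta> < d x w}. q i x w) \<le> \<delta>" if "x \<in> Y" "\<phi> i x \<noteq> 0" "0 < \<delta>" for i x \<delta>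
    using cm[of i] that by (auto simp: controlled_measures_def)
  have \<phi>q_summable: "(\<lambda>w. \<phi> i x * q i x w) summable_on Y" if "x \<in> Y" for i x
    using q1[OF that, of i] by (cases "\<phi> i x = 0") (auto simp: has_sum_iff intro: summable_on_cmult_right)
  have term_le: "(\<Sum>\<^sub>\<infinity>w\<in>Y. \<bar>\<phi> i x * q i x w - \<phi> i y * q i y w\<bar>) \<le> \<bar>\<phi> i x - \<phi> i y\<bar> + \<phi> i y * \<epsilon>'"
    if xy: "x \<in> Y" "y \<in> Y" "d x y \<le> R" for i x y
  proof (cases "\<phi> i x = 0 \<or> \<phi> i y = 0")
    case True
    have one: "(\<Sum>\<^sub>\<infinity>w\<in>Y. \<bar>\<phi> i z * q i z w\<bar>) \<le> \<bar>\<phi> i z\<bar>" if z: "z \<in> Y" for z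
    proof (cases "\<phi> i z = 0")
      case False
      have "(\<Sum>\<^sub>\<infinity>w\<in>Y. \<bar>\<phi> i z * q i z w\<bar>) = (\<Sum>\<^sub>\<infinity>w\<in>Y. \<phi> i z * q i z w)"
        using q0[OF z False] nonneg[OF z] by (intro infsum_cong) auto
      also have "\<dots> = \<phi> i z * 1"
        using has_sum_cmult_right[OF q1[OF z False]] by (rule infsumI)
      finally show ?thesis by simp
    qed simp
    have "0 \<le> \<phi> i y * \<epsilon>'" using nonneg[OF xy(2)] \<open>0 \<le> \<epsilon>'\<close> by simp
    with True one[OF xy(1)] one[OF xy(2)] show ?thesis by auto
  next
    case False
    have s: "(\<lambda>w. \<bar>q i x w - q i y w\<bar>) summable_on Y"
      using False q1 xy by (intro summable_on_abs_diff) (auto simp: has_sum_iff)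
    have H: "((\<lambda>w. \<bar>\<phi> i x - \<phi> i y\<bar> * q i x w + \<phi> i y * \<bar>q i x w - q i y w\<bar>) has_sum
        (\<bar>\<phi> i x - \<phi> i y\<bar> * 1 + \<phi> i y * (\<Sum>\<^sub>\<infinity>w\<in>Y. \<bar>q i x w - q i y w\<bar>))) Y"
      using False q1 xy s by (intro has_sum_add has_sum_cmult_right has_sum_infsum) auto
    have "(\<Sum>\<^sub>\<infinity>w\<in>Y. \<bar>\<phi> i x * q i x w - \<phi> i y * q i y w\<bar>)
        \<le> \<bar>\<phi> i x - \<phi> i y\<bar> * 1 + \<phi> i y * (\<Sum>\<^sub>\<infinity>w\<in>Y. \<bar>q i x w - q i y w\<bar>)"
    proof (rule has_sum_mono[OF has_sum_infsum[OF summable_on_abs_diff] H])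
      fix w assume w: "w \<in> Y"
      have "\<phi> i x * q i x w - \<phi> i y * q i y w
          = (\<phi> i x - \<phi> i y) * q i x w + \<phi> i y * (q i x w - q i y w)"
        by (simp add: algebra_simps)
      then show "\<bar>\<phi> i x * q i x w - \<phi> i y * q i y w\<bar>
          \<le> \<bar>\<phi> i x - \<phi> i y\<bar> * q i x w + \<phi> i y * \<bar>q i x w - q i y w\<bar>"
        using abs_triangle_ineq[of "(\<phi> i x - \<phi> i y) * q i x w" "\<phi> i y * (q i x w - q i y w)"]
          False q0[OF xy(1) _ w, of i] nonneg[OF xy(2), of i] by (simp add: abs_mult)
    qed (use \<phi>q_summable xy in auto)
    also have "\<dots> \<le> \<bar>\<phi> i x - \<phi> i y\<bar> + \<phi> i y * \<epsilon>'"
      using False q2 xy nonneg[OF xy(2), of i] by (auto intro: mult_left_mono)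
    finally show ?thesis .
  qed
  show ?thesis unfolding controlled_measures_def
  proof (intro conjI ballI allI impI)
    fix x w assume "x \<in> Y" "w \<in> Y"
    then show "0 \<le> (\<Sum>i\<in>I x. \<phi> i x * q i x w)"
      using nonneg q0 by (intro sum_nonneg) (auto simp: I_def)
  next
    fix x assume x: "x \<in> Y"
    have "((\<lambda>w. \<Sum>i\<in>I x. \<phi> i x * q i x w) has_sum (\<Sum>i\<in>I x. \<phi> i x * 1)) Y"
      using q1[OF x] fin[OF x] by (intro has_sum_finite_sum has_sum_cmult_right) (auto simp: I_def)
    then show "((\<lambda>w. \<Sum>i\<in>I x. \<phi> i x * q i x w) has_sum 1) Y" using part[OF x] by simp
  next
    fix x y assume xy: "x \<in> Y" "y \<in> Y" "d x y \<le> R"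
    define J where "J = I x \<union> I y"
    have J: "finite J" using fin xy by (simp add: J_def)
    \<comment> \<open>Both combinations are written over the common index set \<open>J\<close>; the
      added indices have weight zero.\<close>
    have ext: "(\<Sum>i\<in>I z. \<phi> i z * F i) = (\<Sum>i\<in>J. \<phi> i z * F i)" if "z = x \<or> z = y" for z and F :: "'i \<Rightarrow> real"
      using that J by (intro sum.mono_neutral_left) (auto simp: J_def I_def)
    let ?T = "\<lambda>i w. \<bar>\<phi> i x * q i x w - \<phi> i y * q i y w\<bar>"
    have T: "((\<lambda>w. \<Sum>i\<in>J. ?T i w) has_sum (\<Sum>i\<in>J. infsum (?T i) Y)) Y"
      using J \<phi>q_summable xy by (intro has_sum_finite_sum has_sum_infsum summable_on_abs_diff) auto
    have le: "\<bar>(\<Sum>i\<in>I x. \<phi> i x * q i x w) - (\<Sum>i\<in>I y. \<phi> i y * q i y w)\<bar> \<le> (\<Sum>i\<in>J. ?T i w)" for w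
      using ext[of x "\<lambda>i. q i x w"] ext[of y "\<lambda>i. q i y w"] by (simp add: sum_abs flip: sum_subtractf)
    have "(\<Sum>\<^sub>\<infinity>w\<in>Y. \<bar>(\<Sum>i\<in>I x. \<phi> i x * q i x w) - (\<Sum>i\<in>I y. \<phi> i y * q i y w)\<bar>)
        \<le> (\<Sum>i\<in>J. infsum (?T i) Y)"
      by (rule has_sum_mono[OF has_sum_infsum T le])
        (rule summable_on_comparison_test[OF has_sum_imp_summable[OF T] le], simp)
    also have "\<dots> \<le> (\<Sum>i\<in>J. \<bar>\<phi> i x - \<phi> i y\<bar> + \<phi> i y * \<epsilon>')"
      by (intro sum_mono term_le xy)
    \<comment> \<open>The weights at \<open>y\<close> add up to 1, so \<open>\<epsilon>'\<close> is
      averaged and not multiplied by the number of indices.\<close>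
    also have "\<dots> = (\<Sum>i\<in>J. \<bar>\<phi> i x - \<phi> i y\<bar>) + (\<Sum>i\<in>I y. \<phi> i y) * \<epsilon>'"
      using ext[of y "\<lambda>_. \<epsilon>'"] by (simp add: sum.distrib sum_distrib_right)
    also have "\<dots> \<le> \<epsilon> + \<epsilon>'" using \<phi>_var[OF xy] part[OF xy(2)] by (simp add: J_def)
    finally show "(\<Sum>\<^sub>\<infinity>w\<in>Y. \<bar>(\<Sum>i\<in>I x. \<phi> i x * q i x w) - (\<Sum>i\<in>I y. \<phi> i y * q i y w)\<bar>) \<le> \<epsilon> + \<epsilon>'" .
  next
    fix \<delta> :: real and x assume \<delta>: "0 < \<delta>" and x: "x \<in> Y"
    let ?A = "{w\<in>Y. \<tau> \<delta> < d x w}"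
    have "((\<lambda>w. \<Sum>i\<in>I x. \<phi> i x * q i x w) has_sum (\<Sum>i\<in>I x. \<phi> i x * infsum (q i x) ?A)) ?A"
      using q1[OF x] fin[OF x]
      by (intro has_sum_finite_sum has_sum_cmult_right has_sum_infsum)
        (auto simp: I_def has_sum_iff intro: summable_on_subset_banach)
    then have "(\<Sum>\<^sub>\<infinity>w\<in>?A. \<Sum>i\<in>I x. \<phi> i x * q i x w) = (\<Sum>i\<in>I x. \<phi> i x * infsum (q i x) ?A)"
      by (rule infsumI)
    also have "\<dots> \<le> (\<Sum>i\<in>I x. \<phi> i x * \<delta>)"
      using q3[OF x _ \<delta>] nonneg[OF x] by (intro sum_mono mult_left_mono) (auto simp: I_def)
    also have "\<dots> = \<delta>" using part[OF x] by (simp flip: sum_distrib_right)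
    finally show "(\<Sum>\<^sub>\<infinity>w\<in>?A. \<Sum>i\<in>I x. \<phi> i x * q i x w) \<le> \<delta>" .
  qed
qed

section \<open>Partitions of unity\<close>

text \<open>With totals \<open>A\<close> and \<open>B\<close>, write
  \<open>u i / A - v i / B\<close> as \<open>(u i - v i) / A + v i * ((B - A) / (A * B))\<close>. In
  the sum over \<open>i\<close> the factor \<open>B\<close> of the second part cancels, and
  \<open>\<bar>B - A\<bar>\<close> is at most the unnormalized variation, so each part contributes
  at most that variation divided by \<open>A\<close>.\<close>

lemma sum_abs_diff_normalized_le:
  fixes u v :: "'i \<Rightarrow> real"
  assumes "finite J" and nonneg: "\<And>i. i \<in> J \<Longrightarrow> 0 \<le> v i"
    and a: "0 < a" "a \<le> sum u J" and b: "0 < sum v J"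
  shows "(\<Sum>i\<in>J. \<bar>u i / sum u J - v i / sum v J\<bar>) \<le> 2 * (\<Sum>i\<in>J. \<bar>u i - v i\<bar>) / a"
proof -
  define A B D where "A = sum u J" and "B = sum v J" and "D = (\<Sum>i\<in>J. \<bar>u i - v i\<bar>)"
  have AB: "0 < A" "0 < B" using a b by (auto simp: A_def B_def)
  have BA: "\<bar>B - A\<bar> \<le> D"
    using sum_abs[of "\<lambda>i. u i - v i" J] by (simp add: A_def B_def D_def sum_subtractf abs_minus_commute)
  have "\<bar>u i / A - v i / B\<bar> \<le> \<bar>u i - v i\<bar> / A + v i * (\<bar>B - A\<bar> / (A * B))" if "i \<in> J" for i
  proof -
    have "u i / A - v i / B = (u i - v i) / A + v i * ((B - A) / (A * B))"
      using AB by (simp add: field_simps)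
    also have "\<bar>\<dots>\<bar> \<le> \<bar>(u i - v i) / A\<bar> + \<bar>v i * ((B - A) / (A * B))\<bar>" by (rule abs_triangle_ineq)
    also have "\<dots> = \<bar>u i - v i\<bar> / A + v i * (\<bar>B - A\<bar> / (A * B))"
      using AB nonneg[OF that] by (simp add: abs_mult)
    finally show ?thesis .
  qed
  then have "(\<Sum>i\<in>J. \<bar>u i / A - v i / B\<bar>) \<le> (\<Sum>i\<in>J. \<bar>u i - v i\<bar> / A + v i * (\<bar>B - A\<bar> / (A * B)))"
    by (rule sum_mono)
  also have "\<dots> = D / A + B * (\<bar>B - A\<bar> / (A * B))"
    by (simp add: sum.distrib D_def B_def sum_divide_distrib sum_distrib_right)
  also have "\<dots> = (D + \<bar>B - A\<bar>) / A" using AB by (simp add: field_simps)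
  also have "\<dots> \<le> 2 * D / A" using BA AB by (intro divide_right_mono) auto
  also have "\<dots> \<le> 2 * D / a"
    using a by (intro divide_left_mono) (auto simp: A_def D_def intro: sum_nonneg mult_pos_pos)
  finally show ?thesis by (simp add: A_def B_def D_def)
qed

text \<open>Normalize the functions \<open>\<psi> U\<close>, the distance to the complement of
  \<open>U\<close> capped at \<open>L\<close>, each of which is 1-Lipschitz. At every point some
  \<open>U\<close> contains the closed ball of radius \<open>L\<close>, so its
  \<open>\<psi> U\<close> attains the cap and the normalizer is at least \<open>L\<close>. At most
  \<open>2 * m\<close> sets contain one of two given points; normalization adds another factor
  2.\<close>

lemma partition_of_unity:
  fixes X :: "'a set"
  assumes M: "Metric_space X d" and "0 < L" and cover: "\<And>U. U \<in> \<U> \<Longrightarrow> U \<subseteq> X"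
    and leb: "lebesgue_number_ge X d \<U> L" and mult: "multiplicity_le X \<U> m"
  obtains \<phi> :: "'a set \<Rightarrow> 'a \<Rightarrow> real" where
    "\<And>U x. x \<in> X \<Longrightarrow> 0 \<le> \<phi> U x"
    "\<And>U x. x \<in> X \<Longrightarrow> \<phi> U x \<noteq> 0 \<Longrightarrow> U \<in> \<U> \<and> x \<in> U"
    "\<And>x. x \<in> X \<Longrightarrow> finite {U. \<phi> U x \<noteq> 0}"
    "\<And>x. x \<in> X \<Longrightarrow> (\<Sum>U | \<phi> U x \<noteq> 0. \<phi> U x) = 1"
    "\<And>x y. x \<in> X \<Longrightarrow> y \<in> X \<Longrightarrow>
      (\<Sum>U\<in>{U. \<phi> U x \<noteq> 0} \<union> {U. \<phi> U y \<noteq> 0}. \<bar>\<phi> U x - \<phi> U y\<bar>) \<le> 4 * real m * d x y / L"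
proof -
  interpret Metric_space X d by (rule M)
  define P where "P x = {U\<in>\<U>. x \<in> U}" for x
  \<comment> \<open>Inserting \<open>L\<close> keeps the infimum meaningful for \<open>U = X\<close>.\<close>
  define \<psi> where "\<psi> U x = Inf (insert L (d x ` (X - U)))" for U x
  have P: "finite (P x)" "card (P x) \<le> m" if "x \<in> X" for x
    using mult that by (auto simp: multiplicity_le_def P_def)
  have bdd: "bdd_below (insert L (d x ` (X - U)))" for x U
    using \<open>0 < L\<close> by (intro bdd_belowI[of _ 0]) auto
  have \<psi>_le: "\<psi> U x \<le> L" "y \<in> X - U \<Longrightarrow> \<psi> U x \<le> d x y" for U x y
    unfolding \<psi>_def using bdd by (auto intro!: cInf_lower)
  have \<psi>_ge: "c \<le> \<psi> U x" if "c \<le> L" "\<And>y. y \<in> X - U \<Longrightarrow> c \<le> d x y" for c U x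
    unfolding \<psi>_def using that by (intro cInf_greatest) auto
  have \<psi>_nonneg: "0 \<le> \<psi> U x" for U x using \<open>0 < L\<close> by (intro \<psi>_ge) auto
  have \<psi>_0: "\<psi> U x = 0" if "x \<in> X" "x \<notin> U" for U x
    using \<psi>_le(2)[of x U x] \<psi>_nonneg[of U x] that by simp
  have lip1: "\<psi> U x - d x y \<le> \<psi> U y" if "x \<in> X" "y \<in> X" for U x y
  proof (rule \<psi>_ge)
    show "\<psi> U x - d x y \<le> L" using \<psi>_le(1)[of U x] nonneg[of x y] by linarith
    fix z assume "z \<in> X - U"
    then show "\<psi> U x - d x y \<le> d y z" using \<psi>_le(2)[of z U x] triangle[of x y z] that by auto
  qed
  have lip: "\<bar>\<psi> U x - \<psi> U y\<bar> \<le> d x y" if "x \<in> X" "y \<in> X" for U x y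
    using lip1[OF that, of U] lip1[OF that(2,1), of U] commute[of x y] by linarith
  define N where "N x = (\<Sum>U\<in>P x. \<psi> U x)" for x
  have N_ge: "L \<le> N x" if x: "x \<in> X" for x
  proof -
    obtain U where U: "U \<in> \<U>" "mcball x L \<subseteq> U"
      using leb x \<open>0 < L\<close> unfolding lebesgue_number_ge_def by (metis less_imp_le order_refl)
    then have "U \<in> P x" using x \<open>0 < L\<close> by (auto simp: P_def)
    have "L \<le> \<psi> U x" using U x by (intro \<psi>_ge) (auto simp: subset_iff not_le intro: less_imp_le)
    also have "\<psi> U x \<le> N x"
      unfolding N_def using \<open>U \<in> P x\<close> P(1)[OF x] \<psi>_nonneg by (intro member_le_sum) auto
    finally show ?thesis .
  qed
  define \<phi> where "\<phi> U x = (if U \<in> P x then \<psi> U x / N x else 0)" for U x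
  have supp: "{U. \<phi> U x \<noteq> 0} \<subseteq> P x" for x by (auto simp: \<phi>_def)
  show thesis
  proof (rule that[of \<phi>])
    show "0 \<le> \<phi> U x" if "x \<in> X" for U x
      using \<psi>_nonneg N_ge[OF that] \<open>0 < L\<close> by (auto simp: \<phi>_def)
    show "U \<in> \<U> \<and> x \<in> U" if "\<phi> U x \<noteq> 0" for U x
      using that by (auto simp: \<phi>_def P_def split: if_splits)
    show "finite {U. \<phi> U x \<noteq> 0}" if "x \<in> X" for x
      using supp P(1)[OF that] by (rule finite_subset)
    show "(\<Sum>U | \<phi> U x \<noteq> 0. \<phi> U x) = 1" if "x \<in> X" for x
    proof -
      have "(\<Sum>U | \<phi> U x \<noteq> 0. \<phi> U x) = (\<Sum>U\<in>P x. \<phi> U x)"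
        using supp P(1)[OF that] by (intro sum.mono_neutral_left) auto
      also have "\<dots> = (\<Sum>U\<in>P x. \<psi> U x) / N x" by (simp add: \<phi>_def sum_divide_distrib)
      also have "\<dots> = 1" using N_ge[OF that] \<open>0 < L\<close> by (simp add: N_def)
      finally show ?thesis .
    qed
    show "(\<Sum>U\<in>{U. \<phi> U x \<noteq> 0} \<union> {U. \<phi> U y \<noteq> 0}. \<bar>\<phi> U x - \<phi> U y\<bar>) \<le> 4 * real m * d x y / L"
      if xy: "x \<in> X" "y \<in> X" for x y
    proof -
      define J where "J = P x \<union> P y"
      have J: "finite J" using P xy by (simp add: J_def)
      have "card J \<le> m + m"
        unfolding J_def using card_Un_le[of "P x" "P y"] P(2)[OF xy(1)] P(2)[OF xy(2)] by linarith
      then have card_J: "real (card J) \<le> 2 * real m" by linarith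
      \<comment> \<open>Since \<open>\<psi> U\<close> vanishes outside \<open>U\<close>, the sums at
        \<open>x\<close> and at \<open>y\<close> may both run over \<open>J\<close>, as the estimate
        for normalized families requires.\<close>
      have N: "N z = (\<Sum>U\<in>J. \<psi> U z)" if "z = x \<or> z = y" for z
        unfolding N_def using that J xy \<psi>_0
        by (intro sum.mono_neutral_left) (auto simp: J_def P_def)
      have \<phi>: "\<phi> U z = \<psi> U z / N z" if "U \<in> J" "z = x \<or> z = y" for U z
        using that xy \<psi>_0 by (auto simp: \<phi>_def J_def P_def)
      have "(\<Sum>U\<in>{U. \<phi> U x \<noteq> 0} \<union> {U. \<phi> U y \<noteq> 0}. \<bar>\<phi> U x - \<phi> U y\<bar>) \<le> (\<Sum>U\<in>J. \<bar>\<phi> U x - \<phi> U y\<bar>)"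
        using supp J by (intro sum_mono2) (auto simp: J_def)
      also have "\<dots> = (\<Sum>U\<in>J. \<bar>\<psi> U x / N x - \<psi> U y / N y\<bar>)" by (intro sum.cong) (auto simp: \<phi>)
      also have "\<dots> \<le> 2 * (\<Sum>U\<in>J. \<bar>\<psi> U x - \<psi> U y\<bar>) / L"
        using sum_abs_diff_normalized_le[OF J, of "\<lambda>U. \<psi> U y" L "\<lambda>U. \<psi> U x"]
          \<psi>_nonneg \<open>0 < L\<close> N_ge[OF xy(1)] N_ge[OF xy(2)] N by simp
      also have "\<dots> \<le> 2 * (\<Sum>U\<in>J. d x y) / L"
        using lip[OF xy] \<open>0 < L\<close> by (intro divide_right_mono mult_left_mono sum_mono) auto
      also have "\<dots> = 2 * (real (card J) * d x y) / L" by simp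
      also have "\<dots> \<le> 2 * (2 * real m * d x y) / L"
        using card_J \<open>0 < L\<close> by (intro divide_right_mono mult_left_mono mult_right_mono) auto
      finally show ?thesis by simp
    qed
  qed
qed

section \<open>Word metrics and the orbit map\<close>

lemma map_dist_le_D:
  assumes "map_dist X d f f' \<le> ennreal c" "0 \<le> c" "x \<in> X"
  shows "d (f x) (f' x) \<le> c"
proof -
  have "ennreal (d (f x) (f' x)) \<le> ennreal c"
    using SUP_upper[OF assms(3)] assms(1) unfolding map_dist_def by (rule order_trans)
  then show ?thesis using assms(2) by (simp add: ennreal_le_iff)
qed

context group
begin

lemma word_dist_left_translate:
  assumes "a \<in> carrier G" "g \<in> carrier G" "h \<in> carrier G"
  shows "word_dist G S (a \<otimes> g) (a \<otimes> h) = word_dist G S g h"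
proof -
  have "inv (a \<otimes> g) \<otimes> (a \<otimes> h) = inv g \<otimes> h"
    using assms by (simp add: inv_mult_group m_assoc) (simp flip: m_assoc)
  then show ?thesis using assms by (simp add: word_dist_def)
qed

lemma bij_betw_left_translate:
  assumes "a \<in> carrier G"
  shows "bij_betw (\<lambda>g. a \<otimes> g) (carrier G) (carrier G)"
  by (rule bij_betw_byWitness[where f' = "\<lambda>g. inv a \<otimes> g"]) (use assms in \<open>auto simp flip: m_assoc\<close>)

text \<open>Such elements are products of bounded-length words over a finite alphabet. The
  finiteness makes the displacement of the base point uniformly bounded over the ball.\<close>

lemma finite_word_length_ball:
  assumes S: "finite_symmetric_generating_set G S"
  shows "finite {w\<in>carrier G. real (word_length G S w) \<le> R}"
proof -
  let ?L = "{ws. set ws \<subseteq> S \<and> length ws \<le> nat \<lceil>R\<rceil>}"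
  have "{w\<in>carrier G. real (word_length G S w) \<le> R} \<subseteq> (\<lambda>ws. foldr (\<otimes>) ws \<one>) ` ?L"
  proof
    fix w assume w: "w \<in> {w\<in>carrier G. real (word_length G S w) \<le> R}"
    then obtain ws where "set ws \<subseteq> S" "length ws = word_length G S w" "foldr (\<otimes>) ws \<one> = w"
      using word_length_witness[OF S] by auto
    moreover have "word_length G S w \<le> nat \<lceil>R\<rceil>" using w by (simp add: le_nat_iff) linarith
    ultimately show "w \<in> (\<lambda>ws. foldr (\<otimes>) ws \<one>) ` ?L" by force
  qed
  moreover have "finite ?L"
    using S by (intro finite_lists_length_le) (simp add: finite_symmetric_generating_set_def)
  ultimately show ?thesis using finite_surj by blast
qed

end

section \<open>Quasi-actions with fixed constants\<close>

locale bornologous_quasi_action = group G + Metric_space X d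
  for G :: "('g, 'm) monoid_scheme" (structure) and X :: "'x set" and d +
  fixes f :: "'g \<Rightarrow> 'x \<Rightarrow> 'x" and l :: "real \<Rightarrow> real" and A B :: real and x\<^sub>0 :: 'x
  assumes maps: "g \<in> carrier G \<Longrightarrow> x \<in> X \<Longrightarrow> f g x \<in> X"
    and bornologous: "g \<in> carrier G \<Longrightarrow> bornologous_wrt l X d d (f g)"
    and near_id: "x \<in> X \<Longrightarrow> d (f \<one> x) x \<le> A"
    and near_mult: "g \<in> carrier G \<Longrightarrow> h \<in> carrier G \<Longrightarrow> x \<in> X \<Longrightarrow> d (f g (f h x)) (f (g \<otimes> h) x) \<le> B"
    and base: "x\<^sub>0 \<in> X"
begin

lemma dist_map_le:
  assumes "g \<in> carrier G" "x \<in> X" "y \<in> X" "d x y \<le> r"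
  shows "d (f g x) (f g y) \<le> l r"
  using bornologous[OF assms(1)] assms order_trans[OF nonneg assms(4)]
  unfolding bornologous_wrt_def by blast

text \<open>Write \<open>h\<close> as \<open>g \<otimes> w\<close> with \<open>w\<close> in the
  finite ball of radius \<open>R\<close>. These \<open>w\<close> move the base point by at most
  \<open>m\<close>, the map \<open>f g\<close> turns this into at most \<open>l m\<close>, and
  replacing the composite of \<open>f g\<close> and \<open>f w\<close> by \<open>f h\<close> costs
  \<open>B\<close>.\<close>

lemma orbit_map_bornologous:
  assumes S: "finite_symmetric_generating_set G S"
  obtains C where "0 < C"
    "\<And>g h. g \<in> carrier G \<Longrightarrow> h \<in> carrier G \<Longrightarrow> word_dist G S g h \<le> R \<Longrightarrow> d (f g x\<^sub>0) (f h x\<^sub>0) \<le> C"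
proof -
  let ?W = "{w\<in>carrier G. real (word_length G S w) \<le> R}"
  \<comment> \<open>Inserting 0 keeps the maximum defined when \<open>R\<close> is negative and the
    ball is empty.\<close>
  define m where "m = Max (insert 0 ((\<lambda>w. d x\<^sub>0 (f w x\<^sub>0)) ` ?W))"
  have fin: "finite (insert 0 ((\<lambda>w. d x\<^sub>0 (f w x\<^sub>0)) ` ?W))"
    using finite_word_length_ball[OF S] by simp
  have m: "d x\<^sub>0 (f w x\<^sub>0) \<le> m" if "w \<in> ?W" for w
    unfolding m_def using fin that by (intro Max_ge) auto
  show thesis
  proof (rule that[of "\<bar>l m + B\<bar> + 1"])
    fix g h assume gh: "g \<in> carrier G" "h \<in> carrier G" "word_dist G S g h \<le> R"
    define w where "w = inv g \<otimes> h"
    have w: "w \<in> carrier G" "g \<otimes> w = h"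
      using gh by (auto simp: w_def simp flip: m_assoc)
    have "w \<in> ?W" using gh w by (simp add: word_dist_def w_def)
    then have "d (f g x\<^sub>0) (f g (f w x\<^sub>0)) \<le> l m"
      using gh w base by (intro dist_map_le m maps) auto
    moreover have "d (f g (f w x\<^sub>0)) (f h x\<^sub>0) \<le> B" using near_mult[OF gh(1) w(1) base] w by simp
    ultimately show "d (f g x\<^sub>0) (f h x\<^sub>0) \<le> \<bar>l m + B\<bar> + 1"
      using triangle[of "f g x\<^sub>0" "f g (f w x\<^sub>0)" "f h x\<^sub>0"] gh w base by (simp add: maps)
  qed simp
qed

text \<open>Follow the base point from its image under \<open>f (inv h \<otimes> g)\<close> to
  \<open>f (inv h)\<close> applied to the orbit point of \<open>g\<close> (cost \<open>B\<close>),
  then to that of \<open>h\<close> (cost \<open>l D\<close>), then to its image under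
  \<open>f \<one>\<close> (cost \<open>B\<close>), and finally to itself (cost \<open>A\<close>).
  The total does not depend on \<open>g\<close> and \<open>h\<close>, so all pieces of bounded
  diameter reach the same quasi-stabilizer.\<close>

lemma translate_in_quasi_stabilizer:
  assumes g: "g \<in> carrier G" and h: "h \<in> carrier G" and "d (f g x\<^sub>0) (f h x\<^sub>0) \<le> D"
  shows "inv h \<otimes> g \<in> quasi_stabilizer G d f x\<^sub>0 (2 * B + l D + A)"
proof -
  let ?k = "inv h"
  have k: "?k \<in> carrier G" using h by simp
  have X: "f (?k \<otimes> g) x\<^sub>0 \<in> X" "f ?k (f g x\<^sub>0) \<in> X" "f ?k (f h x\<^sub>0) \<in> X" "f \<one> x\<^sub>0 \<in> X"
    using g h k base by (auto simp: maps)
  have "d (f (?k \<otimes> g) x\<^sub>0) (f ?k (f g x\<^sub>0)) \<le> B" using near_mult[OF k g base] by (simp add: commute)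
  moreover have "d (f ?k (f g x\<^sub>0)) (f ?k (f h x\<^sub>0)) \<le> l D"
    using assms base by (intro dist_map_le maps) auto
  moreover have "d (f ?k (f h x\<^sub>0)) (f \<one> x\<^sub>0) \<le> B" using near_mult[OF k h base] h by simp
  moreover have "d (f \<one> x\<^sub>0) x\<^sub>0 \<le> A" by (rule near_id[OF base])
  ultimately have "d (f (?k \<otimes> g) x\<^sub>0) x\<^sub>0 \<le> 2 * B + l D + A"
    using triangle[OF X(1,2) base] triangle[OF X(2,3) base] triangle[OF X(3,4) base] by linarith
  then show ?thesis using g h by (simp add: quasi_stabilizer_def)
qed

theorem strongly_embeddable_if_quasi_stabilizers:
  assumes S: "finite_symmetric_generating_set G S"
    and asdim: "finite_asymptotic_dimension X d"
    and stab: "\<And>T. 0 < T \<Longrightarrow> strongly_embeddable (quasi_stabilizer G d f x\<^sub>0 T) (word_dist G S)"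
  shows "strongly_embeddable (carrier G) (word_dist G S)"
proof (rule strongly_embeddable_if_controlled_measures[OF Metric_space_word_dist[OF S]])
  fix R \<epsilon> :: real assume R: "0 < R" and \<epsilon>: "0 < \<epsilon>"
  let ?e = "word_dist G S"
  obtain k where k: "\<And>L. 0 \<le> L \<Longrightarrow> \<exists>\<U>. uniformly_bounded_cover X d \<U> \<and> lebesgue_number_ge X d \<U> L \<and>
      multiplicity_le X \<U> (k + 1)"
    using asdim unfolding finite_asymptotic_dimension_def by blast
  obtain C where C: "0 < C" "\<And>g h. g \<in> carrier G \<Longrightarrow> h \<in> carrier G \<Longrightarrow> ?e g h \<le> R \<Longrightarrow> d (f g x\<^sub>0) (f h x\<^sub>0) \<le> C"
    using orbit_map_bornologous[OF S] by blast
  define K where "K = real (k + 1)"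
  have K: "0 < K" by (simp add: K_def)
  \<comment> \<open>Chosen so that orbit points at distance at most \<open>C\<close> give the
    weights a variation of at most \<open>4 * K * C / L = \<epsilon> / 2\<close>.\<close>
  define L where "L = 8 * K * C / \<epsilon>"
  have L: "0 < L" using C K \<epsilon> by (simp add: L_def)
  obtain \<U> where \<U>: "uniformly_bounded_cover X d \<U>" "lebesgue_number_ge X d \<U> L" "multiplicity_le X \<U> (k + 1)"
    using k[of L] L by auto
  obtain D where D: "\<And>U x y. U \<in> \<U> \<Longrightarrow> x \<in> U \<Longrightarrow> y \<in> U \<Longrightarrow> d x y \<le> D"
    using \<U>(1) unfolding uniformly_bounded_cover_def by blast
  have sub: "U \<subseteq> X" if "U \<in> \<U>" for U using \<U>(1) that by (auto simp: uniformly_bounded_cover_def)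
  obtain \<phi> where \<phi>: "\<And>U x. x \<in> X \<Longrightarrow> 0 \<le> \<phi> U x"
    "\<And>U x. x \<in> X \<Longrightarrow> \<phi> U x \<noteq> 0 \<Longrightarrow> U \<in> \<U> \<and> x \<in> U"
    "\<And>x. x \<in> X \<Longrightarrow> finite {U. \<phi> U x \<noteq> 0}"
    "\<And>x. x \<in> X \<Longrightarrow> (\<Sum>U | \<phi> U x \<noteq> 0. \<phi> U x) = 1"
    "\<And>x y. x \<in> X \<Longrightarrow> y \<in> X \<Longrightarrow>
      (\<Sum>U\<in>{U. \<phi> U x \<noteq> 0} \<union> {U. \<phi> U y \<noteq> 0}. \<bar>\<phi> U x - \<phi> U y\<bar>) \<le> 4 * K * d x y / L"
    using partition_of_unity[OF Metric_space_axioms L sub \<U>(2,3), folded K_def] by blast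
  have orbit: "f g x\<^sub>0 \<in> X" if "g \<in> carrier G" for g using that base by (rule maps)
  \<comment> \<open>Dominates the constant of \<open>translate_in_quasi_stabilizer\<close> and is
    positive, as \<open>stab\<close> demands.\<close>
  define T where "T = \<bar>2 * B + l D + A\<bar> + 1"
  define W where "W = quasi_stabilizer G d f x\<^sub>0 T"
  have W: "W \<subseteq> carrier G" by (auto simp: W_def quasi_stabilizer_def)
  have "Metric_space W ?e"
    using Metric_space.subspace[OF Metric_space_word_dist[OF S] W] .
  \<comment> \<open>One choice of \<open>\<tau>\<close> and \<open>p\<close>, made before any piece
    \<open>U\<close> is considered, is what gives all pieces common tails.\<close>
  then obtain \<tau> p where p: "controlled_measures W ?e W R (\<epsilon> / 2) \<tau> p"
    using strongly_embeddable_imp_controlled_measures[of W ?e R "\<epsilon> / 2"] stab[of T] R \<epsilon>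
    by (auto simp: W_def T_def)
  have "\<exists>q. controlled_measures (carrier G) ?e {g\<in>carrier G. \<phi> U (f g x\<^sub>0) \<noteq> 0} R (\<epsilon> / 2) \<tau> q" for U
  \<comment> \<open>The index \<open>U\<close> ranges over all sets, and those outside the cover
    have empty support. An empty piece offers no \<open>h\<close> to translate by, but its condition
    is vacuous.\<close>
  proof (cases "{g\<in>carrier G. \<phi> U (f g x\<^sub>0) \<noteq> 0} = {}")
    case True
    show ?thesis unfolding True by (simp add: controlled_measures_def)
  next
    case False
    \<comment> \<open>Any element of the piece serves as origin: its inverse translates the whole
      piece into \<open>W\<close>, because the orbit points of the piece all lie in
      \<open>U\<close>, of diameter at most \<open>D\<close>.\<close>
    then obtain h where h: "h \<in> carrier G" "\<phi> U (f h x\<^sub>0) \<noteq> 0" by blast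
    have "inv h \<otimes> g \<in> W" if g: "g \<in> carrier G" "\<phi> U (f g x\<^sub>0) \<noteq> 0" for g
    proof -
      have "d (f g x\<^sub>0) (f h x\<^sub>0) \<le> D"
        using \<phi>(2)[OF orbit] g h by (intro D[of U]) auto
      then have "inv h \<otimes> g \<in> quasi_stabilizer G d f x\<^sub>0 (2 * B + l D + A)"
        using g h by (intro translate_in_quasi_stabilizer)
      then show ?thesis by (auto simp: W_def T_def quasi_stabilizer_def)
    qed
    then have "controlled_measures (carrier G) ?e {g\<in>carrier G. \<phi> U (f g x\<^sub>0) \<noteq> 0} R (\<epsilon> / 2) \<tau>
        (\<lambda>x w. if inv h \<otimes> w \<in> W then p (inv h \<otimes> x) (inv h \<otimes> w) else 0)"
      using h by (intro controlled_measures_transport[OF p W] bij_betw_left_translate word_dist_left_translate) auto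
    then show ?thesis by blast
  qed
  then obtain q where
    "\<And>U. controlled_measures (carrier G) ?e {g\<in>carrier G. \<phi> U (f g x\<^sub>0) \<noteq> 0} R (\<epsilon> / 2) \<tau> (q U)"
    by metis
  then have "controlled_measures (carrier G) ?e (carrier G) R (\<epsilon> / 2 + \<epsilon> / 2) \<tau>
      (\<lambda>g w. \<Sum>U | \<phi> U (f g x\<^sub>0) \<noteq> 0. \<phi> U (f g x\<^sub>0) * q U g w)"
  proof (intro controlled_measures_glue[where \<phi> = "\<lambda>U g. \<phi> U (f g x\<^sub>0)"])
    fix g h assume gh: "g \<in> carrier G" "h \<in> carrier G" "?e g h \<le> R"
    have "(\<Sum>U\<in>{U. \<phi> U (f g x\<^sub>0) \<noteq> 0} \<union> {U. \<phi> U (f h x\<^sub>0) \<noteq> 0}. \<bar>\<phi> U (f g x\<^sub>0) - \<phi> U (f h x\<^sub>0)\<bar>)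
        \<le> 4 * K * d (f g x\<^sub>0) (f h x\<^sub>0) / L"
      using gh by (intro \<phi>(5) orbit)
    also have "\<dots> \<le> 4 * K * C / L"
      using C(2)[OF gh] K L by (intro divide_right_mono mult_left_mono) auto
    also have "\<dots> = \<epsilon> / 2" using C K \<epsilon> by (simp add: L_def field_simps)
    finally show "(\<Sum>U\<in>{U. \<phi> U (f g x\<^sub>0) \<noteq> 0} \<union> {U. \<phi> U (f h x\<^sub>0) \<noteq> 0}.
        \<bar>\<phi> U (f g x\<^sub>0) - \<phi> U (f h x\<^sub>0)\<bar>) \<le> \<epsilon> / 2" .
  qed (use \<phi> orbit \<epsilon> in auto)
  then show "\<exists>\<tau> p. controlled_measures (carrier G) ?e (carrier G) R \<epsilon> \<tau> p" by auto
qed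

end

section \<open>From a coarse quasi-action to fixed constants\<close>

theorem theorem1p1:
  fixes G :: "('g, 'm) monoid_scheme" and S :: "'g set"
    and X :: "'x set" and d :: "'x \<Rightarrow> 'x \<Rightarrow> real"
    and f :: "'g \<Rightarrow> 'x \<Rightarrow> 'x"
  assumes "group G"
    and "finite_symmetric_generating_set G S"
    and "Metric_space X d"
    and "uniformly_discrete X d"
    and "bounded_geometry X d"
    and "coarse_quasi_action G X d f"
    and "finite_asymptotic_dimension X d"
    and "\<exists>x\<^sub>0\<in>X. \<forall>T>0. strongly_embeddable (quasi_stabilizer G d f x\<^sub>0 T) (word_dist G S)"
  shows "strongly_embeddable (carrier G) (word_dist G S)"
proof -
  obtain x\<^sub>0 where x\<^sub>0: "x\<^sub>0 \<in> X"
    and stab: "\<And>T. 0 < T \<Longrightarrow> strongly_embeddable (quasi_stabilizer G d f x\<^sub>0 T) (word_dist G S)"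
    using assms(8) by blast
  have maps: "f g x \<in> X" if "g \<in> carrier G" "x \<in> X" for g x
    using assms(6) that
    by (auto simp: coarse_quasi_action_def coarse_self_equivalence_def coarse_map_def)
  obtain l where l: "\<And>g. g \<in> carrier G \<Longrightarrow> bornologous_wrt l X d d (f g)"
    using assms(6) unfolding coarse_quasi_action_def by blast
  obtain A where A: "0 \<le> A" "map_dist X d (f \<one>\<^bsub>G\<^esub>) id \<le> ennreal A"
    using assms(6) unfolding coarse_quasi_action_def by blast
  obtain B where B: "0 \<le> B"
    "\<And>g h. g \<in> carrier G \<Longrightarrow> h \<in> carrier G \<Longrightarrow> map_dist X d (f g \<circ> f h) (f (g \<otimes>\<^bsub>G\<^esub> h)) \<le> ennreal B"
    using assms(6) unfolding coarse_quasi_action_def by blast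
  \<comment> \<open>The bounds on suprema in \<open>ennreal\<close> become pointwise real bounds
    through \<open>map_dist_le_D\<close>, which relies on \<open>A\<close> and \<open>B\<close>
    being nonnegative.\<close>
  have "bornologous_quasi_action G X d f l A B x\<^sub>0"
  proof (intro bornologous_quasi_action.intro bornologous_quasi_action_axioms.intro assms(1,3))
    show "d (f \<one>\<^bsub>G\<^esub> x) x \<le> A" if "x \<in> X" for x
      using map_dist_le_D[OF A(2,1) that] by simp
    show "d (f g (f h x)) (f (g \<otimes>\<^bsub>G\<^esub> h) x) \<le> B" if "g \<in> carrier G" "h \<in> carrier G" "x \<in> X" for g h x
      using map_dist_le_D[OF B(2)[OF that(1,2)] B(1) that(3)] by simp
  qed (use maps l x\<^sub>0 in auto)
  then show ?thesis
    using assms(2,7) stab by (rule bornologous_quasi_action.strongly_embeddable_if_quasi_stabilizers)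
qed

end
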